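(* Let $n$ be a positive integer. Suppose that there exist integers $M \ge K \ge 0$ and $n \times n$ positive definite matrices $A$ and $B$ such that $\mathrm{Tr}[S_{M,K}(A,B)] < 0$. Then, for any integers $m \geq M$ and $k \geq K$ such that $m-k \geq M-K$, there exist $n \times n$ positive definite matrices $A'$ and $B'$ such that $\mathrm{Tr}[S_{m,k}(A',B')] < 0$.
   Context: Matrices are complex. A positive definite matrix is a complex Hermitian matrix all of whose eigenvalues are positive. For $n\times n$ matrices $A,B$ and integers $m\ge 0$, $0\le k\le m$, $S_{m,k}(A,B)$ denotes the sum of all words of length $m$ in $A$ and $B$ in which exactly $k$ $B$'s appear, i.e. the (matrix) coefficient of $t^k$ in $(A+tB)^m$ (so $S_{0,0}(A,B)=I$). When $A,B$ are Hermitian, $\mathrm{Tr}[S_{m,k}(A,B)]$ is real. *)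

theory Defs
  imports "HOL-Analysis.Analysis" "HOL-Library.Complex_Order"
begin

definition hermitian :: "complex^'n^'n \<Rightarrow> bool" where
  "hermitian A \<longleftrightarrow> (\<chi> i j. cnj (A $ j $ i)) = A"

definition eigenvalue :: "complex^'n^'n \<Rightarrow> complex \<Rightarrow> bool" where
  "eigenvalue A c \<longleftrightarrow> (\<exists>v. v \<noteq> 0 \<and> A *v v = c *s v)"

(* The order on complex numbers is that of Complex_Order:
   0 < c says that c is real and positive, and c < 0 that c is real and negative. *)
definition positive_definite :: "complex^'n^'n \<Rightarrow> bool" where
  "positive_definite A \<longleftrightarrow> hermitian A \<and> (\<forall>c. eigenvalue A c \<longrightarrow> 0 < c)"

(* A word in two letters is a bool list; False stands for the letter A and True for B.
   Words are kept apart from their values, so that word_sum counts words with multiplicity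
   even when different words have the same product (for example when A = B). *)
definition word_value :: "complex^'n^'n \<Rightarrow> complex^'n^'n \<Rightarrow> bool list \<Rightarrow> complex^'n^'n" where
  "word_value A B w = foldr (\<lambda>b P. (if b then B else A) ** P) w (mat 1)"

definition word_sum :: "nat \<Rightarrow> nat \<Rightarrow> complex^'n^'n \<Rightarrow> complex^'n^'n \<Rightarrow> complex^'n^'n" where
  "word_sum m k A B = (\<Sum>w | length w = m \<and> count_list w True = k. word_value A B w)"

lemma finite_words: "finite {w :: bool list. length w = m \<and> count_list w True = k}"
  by (rule finite_subset[OF _ finite_lists_length_eq[of UNIV m]]) auto

lemma word_sum_0: "word_sum 0 k A B = (if k = 0 then mat 1 else 0)"
proof -
  have "{w :: bool list. length w = 0 \<and> count_list w True = k} = (if k = 0 then {[]} else {})"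
    by auto
  then show ?thesis by (simp add: word_sum_def word_value_def)
qed

lemma matrix_mult_sum_right:
  fixes A :: "complex^'n^'n"
  shows "A ** (\<Sum>x\<in>X. f x) = (\<Sum>x\<in>X. A ** f x)"
  by (induction X rule: infinite_finite_induct) (auto simp: matrix_add_ldistrib)

lemma word_sum_Suc:
  "word_sum (Suc m) k A B = A ** word_sum m k A B + (if k = 0 then 0 else B ** word_sum m (k - 1) A B)"
proof -
  let ?W = "\<lambda>m k. {w :: bool list. length w = m \<and> count_list w True = k}"
  let ?T = "if k = 0 then {} else Cons True ` ?W m (k - 1)"
  have split: "?W (Suc m) k = Cons False ` ?W m k \<union> ?T"
    by (auto simp: length_Suc_conv image_iff split: if_splits)
  have "word_sum (Suc m) k A B
      = (\<Sum>w\<in>Cons False ` ?W m k. word_value A B w) + (\<Sum>w\<in>?T. word_value A B w)"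
    unfolding word_sum_def split by (rule sum.union_disjoint) (auto simp: finite_words)
  also have "(\<Sum>w\<in>Cons False ` ?W m k. word_value A B w) = A ** word_sum m k A B"
    by (simp add: word_sum_def sum.reindex matrix_mult_sum_right word_value_def)
  also have "(\<Sum>w\<in>?T. word_value A B w) = (if k = 0 then 0 else B ** word_sum m (k - 1) A B)"
    by (simp add: word_sum_def sum.reindex matrix_mult_sum_right word_value_def)
  finally show ?thesis .
qed

lemma word_sum_eq_0: "m < k \<Longrightarrow> word_sum m k A B = 0"
  by (induction m arbitrary: k) (auto simp: word_sum_0 word_sum_Suc)

lemma scalar_matrix_left_commute:
  fixes A B :: "complex^'n^'n"
  shows "mat c ** (A ** B) = A ** (mat c ** B)"
proof -
  have "mat c ** A = A ** mat c"
    by (simp add: vec_eq_iff matrix_matrix_mult_def mat_def if_distrib if_distribR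
        sum.delta mult.commute cong: if_cong)
  then show ?thesis by (metis matrix_mul_assoc)
qed

(* word_sum m k A B is the coefficient of t^k in (A + tB)^m; the matrix tB is mat t ** B. *)
lemma word_sum_generating:
  fixes A B :: "complex^'n^'n"
  shows "((\<lambda>X. (A + mat t ** B) ** X) ^^ m) (mat 1) = (\<Sum>k\<le>m. mat (t ^ k) ** word_sum m k A B)"
proof (induction m)
  case 0
  then show ?case by (simp add: word_sum_0)
next
  case (Suc m)
  have mm: "mat (t * t ^ k) = mat t ** (mat (t ^ k) :: complex^'n^'n)" for k
  proof -
    have "(if i = l then t else 0) * x = (if l = i then t * x else 0)" for i l :: 'n and x
      by simp
    then show ?thesis
      by (simp add: vec_eq_iff matrix_matrix_mult_def mat_def)
  qed
  have rd: "(X + Y) ** Z = X ** Z + Y ** Z" for X Y Z :: "complex^'n^'n"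
    by (simp add: vec_eq_iff matrix_matrix_mult_def distrib_right sum.distrib)
  have sh1: "mat (t * t ^ k) ** (B ** word_sum m k A B) = mat t ** B ** (mat (t ^ k) ** word_sum m k A B)" for k
    by (simp only: mm matrix_mul_assoc[symmetric] scalar_matrix_left_commute[of _ B])
  have sh: "(\<Sum>k\<le>Suc m. mat (t ^ k) ** (if k = 0 then 0 else B ** word_sum m (k - 1) A B))
      = (\<Sum>k\<le>m. mat t ** B ** (mat (t ^ k) ** word_sum m k A B))"
    by (subst sum.atMost_Suc_shift) (simp add: sh1)
  have "(\<Sum>k\<le>Suc m. mat (t ^ k) ** word_sum (Suc m) k A B)
      = (\<Sum>k\<le>Suc m. A ** (mat (t ^ k) ** word_sum m k A B))
      + (\<Sum>k\<le>Suc m. mat (t ^ k) ** (if k = 0 then 0 else B ** word_sum m (k - 1) A B))"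
    by (simp only: word_sum_Suc matrix_add_ldistrib sum.distrib
        scalar_matrix_left_commute[of _ A])
  also have "\<dots> = (A + mat t ** B) ** (\<Sum>k\<le>m. mat (t ^ k) ** word_sum m k A B)"
    unfolding sh by (simp add: word_sum_eq_0 matrix_mult_sum_right rd sum.distrib)
  finally show ?case using Suc by simp
qed

end

theory Submission
  imports Defs
begin

text \<open>
  Write \<open>S m k\<close> for \<open>word_sum m k\<close>. It suffices to pass from \<open>(m, k)\<close> to \<open>(m + 1, k)\<close> and to
  \<open>(m + 1, k + 1)\<close>, since every target is reached by adding letters \<open>A\<close> and \<open>B\<close> one at a time.

  Suppose the trace of \<open>S m k\<close> is negative somewhere. On pairs of positive semidefinite matrices of
  Frobenius norm one, a compact set, it attains a minimum \<open>f < 0\<close>, say at \<open>(A, B)\<close>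
  (\<open>negative_minimiser_exists\<close>); by homogeneity, for all positive semidefinite \<open>A'\<close>, \<open>B'\<close> the trace
  of \<open>S m k A' B'\<close> is at least \<open>f * norm A' ^ (m - k) * norm B' ^ k\<close>. For Hermitian \<open>H\<close> and
  \<open>P = 1 + t H\<close>, the pair \<open>(P A P, P B P)\<close> stays positive semidefinite for every real \<open>t\<close>, so both
  sides of this inequality have the same derivative at \<open>t = 0\<close>. Varying both matrices by the same
  congruence makes the left derivative simple: letting the product rule insert \<open>H\<close> before and after
  each letter of a cyclic word places \<open>H\<close> twice in each gap, so the derivative is \<open>2 m\<close> times the
  trace of \<open>H S m k\<close> (\<open>trace_word_sum_first_variation\<close>). Hence (\<open>minimiser_stationary\<close>)
  \<open>m Re Tr (H S m k) = f ((m - k) Re Tr (H A A) + k Re Tr (H B B))\<close>.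

  Now take for \<open>H\<close> the letter to be added, \<open>A\<close> or \<open>B\<close>. The traces on the right are nonnegative, and
  the one that is the trace of a cube is positive, so \<open>Tr (H S m k) < 0\<close>. Here the weights \<open>m - k\<close>
  and \<open>k\<close> are positive because a power of a single positive semidefinite matrix has nonnegative
  trace. Rotating words shows that \<open>Tr (A S m k)\<close> and \<open>Tr (B S m k)\<close> are positive multiples of
  the traces of \<open>S (m + 1) k\<close> and \<open>S (m + 1) (k + 1)\<close> (\<open>trace_letter_times_word_sum\<close>), which are
  therefore negative too. Finally a small multiple of the identity is added to \<open>A\<close> and \<open>B\<close> to make
  them positive definite; continuity keeps the trace negative.
\<close>

section \<open>Matrix algebra and the Hermitian form\<close>

lemma matrix_mult_bounded_bilinear:
  "bounded_bilinear ((**) :: complex^'n^'n \<Rightarrow> complex^'n^'n \<Rightarrow> complex^'n^'n)"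
  unfolding bilinear_conv_bounded_bilinear[symmetric] bilinear_def
  by (auto intro!: linearI simp: vec_eq_iff matrix_matrix_mult_def algebra_simps sum.distrib
      scaleR_sum_right)

interpretation matrix_mult: bounded_bilinear
  "(**) :: complex^'n^'n \<Rightarrow> complex^'n^'n \<Rightarrow> complex^'n^'n"
  by (rule matrix_mult_bounded_bilinear)

lemma matrix_vector_mult_bounded_bilinear:
  "bounded_bilinear ((*v) :: complex^'n^'n \<Rightarrow> complex^'n \<Rightarrow> complex^'n)"
  unfolding bilinear_conv_bounded_bilinear[symmetric] bilinear_def
  by (auto intro!: linearI simp: vec_eq_iff matrix_vector_mult_def algebra_simps sum.distrib
      scaleR_sum_right)

interpretation matrix_vector_mult: bounded_bilinear
  "(*v) :: complex^'n^'n \<Rightarrow> complex^'n \<Rightarrow> complex^'n"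
  by (rule matrix_vector_mult_bounded_bilinear)

lemma trace_bounded_linear: "bounded_linear (trace :: complex^'n^'n \<Rightarrow> complex)"
  unfolding linear_conv_bounded_linear[symmetric]
  by (auto intro!: linearI simp: trace_def sum.distrib scaleR_sum_right)

lemmas trace_sum = linear_sum[OF bounded_linear.linear[OF trace_bounded_linear]]

definition adjoint_matrix :: "complex^'n^'n \<Rightarrow> complex^'n^'n" where
  "adjoint_matrix A = (\<chi> i j. cnj (A $ j $ i))"

lemma hermitian_iff_adjoint: "hermitian A \<longleftrightarrow> adjoint_matrix A = A"
  by (simp add: hermitian_def adjoint_matrix_def)

lemma adjoint_matrix_mult: "adjoint_matrix (A ** B) = adjoint_matrix B ** adjoint_matrix A"
  by (simp add: adjoint_matrix_def matrix_matrix_mult_def vec_eq_iff mult.commute)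

lemma adjoint_matrix_add: "adjoint_matrix (A + B) = adjoint_matrix A + adjoint_matrix B"
  by (simp add: adjoint_matrix_def vec_eq_iff)

lemma adjoint_matrix_scaleR: "adjoint_matrix (r *\<^sub>R A) = r *\<^sub>R adjoint_matrix A"
  by (simp add: adjoint_matrix_def vec_eq_iff)

lemma adjoint_matrix_one [simp]: "adjoint_matrix (mat 1) = mat 1"
  by (simp add: adjoint_matrix_def vec_eq_iff mat_def)

lemma adjoint_matrix_sum: "adjoint_matrix (\<Sum>x\<in>X. f x) = (\<Sum>x\<in>X. adjoint_matrix (f x))"
  by (simp add: adjoint_matrix_def vec_eq_iff)

lemma trace_adjoint: "trace (adjoint_matrix A) = cnj (trace A)"
  by (simp add: adjoint_matrix_def trace_def)

text \<open>The real inner product of the Euclidean space \<open>complex^'n\<close> is the real part of the Hermitian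
  one, so that \<open>x \<bullet> (A *v x)\<close> is the quadratic form of a Hermitian matrix.\<close>

lemma inner_complex_mult_right: "a \<bullet> (cnj c * b) = (c * a) \<bullet> b" for a b c :: complex
  by (simp add: inner_complex_def algebra_simps)

lemma Re_cnj_mult_eq_inner: "Re (cnj a * z) = a \<bullet> z"
  by (simp add: inner_complex_def)

lemma hermitian_inner_commute:
  assumes "hermitian A"
  shows "x \<bullet> (A *v y) = (A *v x) \<bullet> y"
proof -
  have "A $ i $ j = cnj (A $ j $ i)" for i j
    using assms by (simp add: hermitian_def vec_eq_iff)
  then have A: "a \<bullet> (A $ i $ j * b) = (A $ j $ i * a) \<bullet> b" for i j a b
    by (metis (no_types) inner_complex_mult_right)
  have "x \<bullet> (A *v y) = (\<Sum>i\<in>UNIV. \<Sum>j\<in>UNIV. x $ i \<bullet> (A $ i $ j * y $ j))"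
    by (simp add: inner_vec_def matrix_vector_mult_def inner_sum_right)
  also have "\<dots> = (\<Sum>i\<in>UNIV. \<Sum>j\<in>UNIV. (A $ j $ i * x $ i) \<bullet> y $ j)"
    by (intro sum.cong refl) (rule A)
  also have "\<dots> = (\<Sum>j\<in>UNIV. \<Sum>i\<in>UNIV. (A $ j $ i * x $ i) \<bullet> y $ j)"
    by (rule sum.swap)
  also have "\<dots> = (A *v x) \<bullet> y"
    by (simp add: inner_vec_def matrix_vector_mult_def inner_sum_left)
  finally show ?thesis .
qed

lemma column_eq_mult_axis: "column i A = A *v axis i 1" for A :: "complex^'n^'n"
  by (simp add: column_def vec_eq_iff matrix_vector_mult_def axis_def if_distrib cong: if_cong)

lemma trace_eq_sum_inner:
  "Re (trace A) = (\<Sum>i\<in>UNIV. axis i 1 \<bullet> (A *v axis i 1))"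
  for A :: "complex^'n^'n"
  by (simp add: trace_def inner_axis' inner_complex_def column_def flip: column_eq_mult_axis)

lemma hermitian_trace_mult:
  assumes "hermitian A"
  shows "Re (trace (A ** X)) = A \<bullet> X"
proof -
  have "A $ i $ j = cnj (A $ j $ i)" for i j
    using assms by (simp add: hermitian_def vec_eq_iff)
  then have A: "Re (A $ i $ j * z) = A $ j $ i \<bullet> z" for i j z
    by (metis Re_cnj_mult_eq_inner)
  have "Re (trace (A ** X)) = (\<Sum>i\<in>UNIV. \<Sum>j\<in>UNIV. Re (A $ i $ j * X $ j $ i))"
    by (simp add: trace_def matrix_matrix_mult_def)
  also have "\<dots> = (\<Sum>i\<in>UNIV. \<Sum>j\<in>UNIV. A $ j $ i \<bullet> X $ j $ i)"
    by (intro sum.cong refl) (rule A)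
  also have "\<dots> = (\<Sum>j\<in>UNIV. \<Sum>i\<in>UNIV. A $ j $ i \<bullet> X $ j $ i)"
    by (rule sum.swap)
  also have "\<dots> = A \<bullet> X" by (simp add: inner_vec_def)
  finally show ?thesis .
qed

definition psd :: "complex^'n^'n \<Rightarrow> bool" where
  "psd A \<longleftrightarrow> hermitian A \<and> (\<forall>x. 0 \<le> x \<bullet> (A *v x))"

text \<open>A null vector \<open>v\<close> of a nonnegative form minimises it, so the derivative of the form along
  \<open>v - s A v\<close>, which is \<open>- 2 (A v \<bullet> A v)\<close> at \<open>s = 0\<close>, cannot be negative.\<close>

lemma psd_null_vector:
  assumes "psd A" "v \<bullet> (A *v v) = 0"
  shows "A *v v = 0"
proof (rule ccontr)
  define u where "u = A *v v"
  define q where "q = u \<bullet> (A *v u)"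
  assume "A *v v \<noteq> 0"
  then have u: "u \<bullet> u > 0" by (simp add: u_def)
  have "hermitian A" using assms by (simp add: psd_def)
  then have sym: "v \<bullet> (A *v u) = u \<bullet> u"
    by (simp add: hermitian_inner_commute u_def)
  have q: "q \<ge> 0" using assms by (simp add: psd_def q_def)
  have form: "0 \<le> s\<^sup>2 * q - 2 * s * (u \<bullet> u)" for s :: real
  proof -
    have "0 \<le> (v - s *\<^sub>R u) \<bullet> (A *v (v - s *\<^sub>R u))"
      using assms by (simp add: psd_def)
    also have "\<dots> = v \<bullet> (A *v v) - s * (v \<bullet> (A *v u)) - s * (u \<bullet> (A *v v)) + s\<^sup>2 * q"
      by (simp add: matrix_vector_mult.diff_right matrix_vector_mult.scaleR_right inner_diff_left inner_diff_right
          q_def power2_eq_square algebra_simps)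
    also have "\<dots> = s\<^sup>2 * q - 2 * s * (u \<bullet> u)"
      using assms(2) sym by (simp add: u_def)
    finally show ?thesis .
  qed
  (* any 0 < s < 2 (u \<bullet> u) / q makes the right-hand side negative *)
  define s where "s = (u \<bullet> u) / (q + 1)"
  have s: "s > 0" using u q by (simp add: s_def)
  have "s * q \<le> u \<bullet> u" using u q by (simp add: s_def field_simps)
  then have "s\<^sup>2 * q \<le> s * (u \<bullet> u)" using s by (simp add: power2_eq_square mult.assoc)
  with form[of s] mult_pos_pos[OF s u] show False by linarith
qed

text \<open>The imaginary part of \<open>c\<close> is read off from symmetry of the form at the pair \<open>v\<close>, \<open>\<i> v\<close>.\<close>

lemma hermitian_eigenvalue_real:
  assumes "hermitian A" "A *v v = c *s v" "v \<noteq> 0"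
  shows "Im c = 0" "v \<bullet> (A *v v) = Re c * (v \<bullet> v)"
proof -
  have smul: "x \<bullet> (c *s x) = Re c * (x \<bullet> x)" for x :: "complex^'n" and c
    by (simp add: inner_vec_def inner_complex_def sum_distrib_left algebra_simps)
  show "v \<bullet> (A *v v) = Re c * (v \<bullet> v)" by (simp add: assms(2) smul)
  have iv: "A *v (\<i> *s v) = (\<i> * c) *s v"
    by (simp add: assms(2) vector_scalar_commute mult.commute)
  have "v \<bullet> (A *v (\<i> *s v)) = (A *v v) \<bullet> (\<i> *s v)"
    by (rule hermitian_inner_commute[OF assms(1)])
  then have "v \<bullet> ((\<i> * c) *s v) = (c *s v) \<bullet> (\<i> *s v)"
    by (simp only: iv assms(2))
  moreover have "(c *s v) \<bullet> (\<i> *s v) = Im c * (v \<bullet> v)"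
    by (simp add: inner_vec_def inner_complex_def sum_distrib_left algebra_simps)
  moreover have "v \<bullet> ((\<i> * c) *s v) = - Im c * (v \<bullet> v)" by (simp add: smul)
  ultimately have "Im c * (v \<bullet> v) = 0" by simp
  then show "Im c = 0" using assms(3) by simp
qed

text \<open>The minimum \<open>l\<close> of the form on the unit sphere is an eigenvalue: \<open>A - l\<close> is positive semidefinite
  and its form vanishes at the minimiser, which is therefore in its kernel. This replaces the
  spectral theorem.\<close>

lemma positive_definite_imp_psd:
  fixes A :: "complex^'n^'n"
  assumes "positive_definite A"
  shows "psd A"
proof -
  have herm: "hermitian A" using assms by (simp add: positive_definite_def)
  have "continuous_on (sphere (0 :: complex^'n) 1) (\<lambda>x. x \<bullet> (A *v x))"
    by (intro continuous_intros matrix_vector_mult.continuous_on)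
  then obtain v where v: "v \<in> sphere 0 1"
    and min: "\<And>x. x \<in> sphere 0 1 \<Longrightarrow> v \<bullet> (A *v v) \<le> x \<bullet> (A *v x)"
    using continuous_attains_inf[of "sphere (0 :: complex^'n) 1" "\<lambda>x. x \<bullet> (A *v x)"]
    by auto
  define l where "l = v \<bullet> (A *v v)"
  have vv: "v \<bullet> v = 1" using v by (simp add: norm_eq_1)
  have lower: "l * (x \<bullet> x) \<le> x \<bullet> (A *v x)" for x
  proof (cases "x = 0")
    case False
    have "l \<le> (x /\<^sub>R norm x) \<bullet> (A *v (x /\<^sub>R norm x))"
      unfolding l_def by (rule min) (use False in simp)
    also have "\<dots> = (x \<bullet> (A *v x)) / (norm x)\<^sup>2"
      by (simp add: matrix_vector_mult.scaleR_right power2_eq_square field_simps)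
    finally show ?thesis using False
      by (simp add: field_simps power2_norm_eq_inner)
  qed simp
  have lId: "(l *\<^sub>R mat 1) *v x = l *\<^sub>R x" for x :: "complex^'n"
    by (simp add: matrix_vector_mult.scaleR_left)
  have "hermitian (A - l *\<^sub>R mat 1)"
    using herm by (simp add: hermitian_def vec_eq_iff mat_def)
  then have "psd (A - l *\<^sub>R mat 1)"
    using lower by (simp add: psd_def matrix_vector_mult.diff_left lId inner_diff_right)
  moreover have "v \<bullet> ((A - l *\<^sub>R mat 1) *v v) = 0"
    by (simp add: matrix_vector_mult.diff_left lId inner_diff_right vv) (simp add: l_def)
  ultimately have "(A - l *\<^sub>R mat 1) *v v = 0" by (rule psd_null_vector)
  then have "A *v v = l *\<^sub>R v" by (simp add: matrix_vector_mult.diff_left lId)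
  then have "A *v v = complex_of_real l *s v" by (simp add: vec_eq_iff scaleR_conv_of_real[where 'a = complex])
  moreover have "v \<noteq> 0" using vv by auto
  ultimately have "eigenvalue A (complex_of_real l)" unfolding eigenvalue_def by blast
  then have "0 < complex_of_real l" using assms by (auto simp: positive_definite_def)
  then have "l > 0" by (simp add: less_complex_def)
  then have "0 \<le> x \<bullet> (A *v x)" for x
    using lower[of x] by (smt (verit) inner_ge_zero mult_nonneg_nonneg)
  with herm show ?thesis by (simp add: psd_def)
qed

lemma psd_add_scaled_identity:
  assumes "psd A" "e > 0"
  shows "positive_definite (A + e *\<^sub>R mat 1)"
proof -
  have herm: "hermitian (A + e *\<^sub>R mat 1)"
    using assms(1) by (auto simp: psd_def hermitian_def vec_eq_iff mat_def)
  have "0 < c" if ev: "(A + e *\<^sub>R mat 1) *v v = c *s v" "v \<noteq> 0" for c v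
  proof -
    have "Re c * (v \<bullet> v) = v \<bullet> (A *v v) + e * (v \<bullet> v)"
      using hermitian_eigenvalue_real(2)[OF herm ev]
      by (simp add: matrix_vector_mult.add_left matrix_vector_mult.scaleR_left inner_add_right)
    moreover have "e * (v \<bullet> v) > 0" using assms(2) ev(2) by simp
    moreover have "v \<bullet> (A *v v) \<ge> 0" using assms(1) by (simp add: psd_def)
    ultimately have "Re c * (v \<bullet> v) > 0" by linarith
    then have "Re c > 0" by (metis inner_ge_zero zero_less_mult_pos2 less_eq_real_def mult_zero_right less_irrefl)
    then show ?thesis using hermitian_eigenvalue_real(1)[OF herm ev] by (simp add: less_complex_def)
  qed
  with herm show ?thesis by (auto simp: positive_definite_def eigenvalue_def)
qed

lemma psd_congruence:
  assumes "psd A" "hermitian P"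
  shows "psd (P ** A ** P)"
proof -
  have "hermitian (P ** A ** P)"
    using assms by (simp add: psd_def hermitian_iff_adjoint adjoint_matrix_mult matrix_mul_assoc)
  moreover have "x \<bullet> ((P ** A ** P) *v x) = (P *v x) \<bullet> (A *v (P *v x))" for x
    by (simp add: matrix_vector_mul_assoc[symmetric] hermitian_inner_commute[OF assms(2)])
  ultimately show ?thesis using assms(1) by (simp add: psd_def)
qed

lemma psd_scaleR: "psd A \<Longrightarrow> r \<ge> 0 \<Longrightarrow> psd (r *\<^sub>R A)"
  by (simp add: psd_def hermitian_iff_adjoint adjoint_matrix_scaleR matrix_vector_mult.scaleR_left)

lemma psd_trace_nonneg: "psd A \<Longrightarrow> 0 \<le> Re (trace A)"
  by (simp add: trace_eq_sum_inner psd_def sum_nonneg)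

lemma psd_trace_mult_square_nonneg:
  assumes "psd X" "hermitian Y"
  shows "0 \<le> Re (trace (X ** (Y ** Y)))"
proof -
  have "trace (X ** (Y ** Y)) = trace (Y ** X ** Y)"
    by (metis matrix_mul_assoc trace_mul_sym)
  with psd_trace_nonneg[OF psd_congruence[OF assms]] show ?thesis by simp
qed

lemma psd_trace_eq_0:
  assumes "psd A" "Re (trace A) = 0"
  shows "A = 0"
proof -
  have "axis i 1 \<bullet> (A *v axis i 1) = 0" for i
    using assms sum_nonneg_eq_0_iff[of UNIV "\<lambda>i. axis i 1 \<bullet> (A *v axis i 1)"]
    by (simp add: trace_eq_sum_inner psd_def)
  then have "A *v axis i 1 = 0" for i by (rule psd_null_vector[OF assms(1)])
  then have "column i A = 0" for i by (simp add: column_eq_mult_axis)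
  then show ?thesis by (simp add: column_def vec_eq_iff)
qed

text \<open>The form of the cube of \<open>A\<close> at \<open>x\<close> is the form of \<open>A\<close> at \<open>A x\<close>; if it vanishes identically then
  \<open>A (A x) = 0\<close>, hence \<open>A x = 0\<close> because \<open>A\<close> is Hermitian.\<close>

lemma psd_trace_cube_pos:
  assumes "psd A" "A \<noteq> 0"
  shows "0 < Re (trace (A ** A ** A))"
proof -
  have herm: "hermitian A" using assms by (simp add: psd_def)
  have cube: "psd (A ** A ** A)" by (rule psd_congruence) (use assms herm in auto)
  have "A = 0" if "A ** A ** A = 0"
  proof -
    have "A *v x = 0" for x
    proof -
      have "(A *v x) \<bullet> (A *v (A *v x)) = x \<bullet> ((A ** A ** A) *v x)"
        by (simp add: matrix_vector_mul_assoc[symmetric] hermitian_inner_commute[OF herm])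
      then have "A *v (A *v x) = 0"
        using that by (intro psd_null_vector[OF assms(1)]) (simp add: matrix_vector_mult.zero_left)
      then have "(A *v x) \<bullet> (A *v x) = 0"
        by (simp flip: hermitian_inner_commute[OF herm])
      then show ?thesis by simp
    qed
    then have "column i A = 0" for i by (simp add: column_eq_mult_axis)
    then show ?thesis by (simp add: column_def vec_eq_iff)
  qed
  then have "Re (trace (A ** A ** A)) \<noteq> 0" using psd_trace_eq_0[OF cube] assms(2) by blast
  with psd_trace_nonneg[OF cube] show ?thesis by simp
qed

lemma psd_one [simp]: "psd (mat 1 :: complex^'n^'n)"
  by (simp add: psd_def hermitian_iff_adjoint)

lemma closed_psd: "closed {A :: complex^'n^'n. psd A}"
  unfolding psd_def hermitian_def vec_eq_iff vec_lambda_beta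
  by (intro closed_Collect_conj closed_Collect_all closed_Collect_eq closed_Collect_le
      continuous_intros matrix_vector_mult.continuous_on)

section \<open>Words under rotation and reversal\<close>

abbreviation words :: "nat \<Rightarrow> nat \<Rightarrow> bool list set" where
  "words m k \<equiv> {w. length w = m \<and> count_list w True = k}"

lemma word_value_Nil [simp]: "word_value A B [] = mat 1"
  by (simp add: word_value_def)

lemma word_value_Cons [simp]:
  "word_value A B (c # w) = (if c then B else A) ** word_value A B w"
  by (simp add: word_value_def)

lemma word_value_append: "word_value A B (v @ w) = word_value A B v ** word_value A B w"
  by (induction v) (simp_all add: matrix_mul_assoc)

lemma count_list_rotate: "count_list (rotate i w) x = count_list w x"
proof -
  have "count_list (rotate1 w) x = count_list w x" for w
    by (cases w) auto
  then show ?thesis by (induction i) auto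
qed

lemma count_list_True_add_False: "count_list w True + count_list w False = length w"
  by (induction w) auto

lemma rotate_eq: "i \<le> length w \<Longrightarrow> rotate i w = drop i w @ take i w"
  by (cases "i = length w") (auto simp: rotate_drop_take)

lemma trace_rotate: "trace (word_value A B (rotate i w)) = trace (word_value A B w)"
proof -
  have "trace (word_value A B (rotate1 w)) = trace (word_value A B w)" for w
  proof (cases w)
    case (Cons c v)
    then show ?thesis
      by (simp only: rotate1.simps word_value_append word_value_Cons word_value_Nil matrix_mul_rid)
        (rule trace_mul_sym)
  qed simp
  then show ?thesis by (induction i) auto
qed

lemma bij_betw_rotate_words: "bij_betw (rotate i) (words m k) (words m k)"
proof -
  have inj: "inj_on (rotate i) (words m k)"
    unfolding rotate_def by (rule inj_on_subset[OF inj_fn[OF inj_rotate1]]) simp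
  have "rotate i ` words m k = words m k"
    by (rule endo_inj_surj[OF finite_words _ inj]) (auto simp: count_list_rotate)
  with inj show ?thesis by (simp add: bij_betw_def)
qed

lemma sum_words_rotate: "(\<Sum>w\<in>words m k. f (rotate i w)) = (\<Sum>w\<in>words m k. f w)"
  by (rule sum.reindex_bij_betw[OF bij_betw_rotate_words])

text \<open>The adjoint reverses words, and reversal permutes the words with given letter counts; this makes
  the traces of word sums real.\<close>

lemma adjoint_word_value:
  assumes "hermitian A" "hermitian B"
  shows "adjoint_matrix (word_value A B w) = word_value A B (rev w)"
  by (induction w)
    (use assms in \<open>simp_all add: word_value_append adjoint_matrix_mult hermitian_iff_adjoint\<close>)

lemma hermitian_word_sum:
  assumes "hermitian A" "hermitian B"
  shows "hermitian (word_sum m k A B)"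
proof -
  have "adjoint_matrix (word_sum m k A B) = (\<Sum>w\<in>words m k. word_value A B (rev w))"
    by (simp add: word_sum_def adjoint_matrix_sum adjoint_word_value assms)
  also have "\<dots> = word_sum m k A B"
    unfolding word_sum_def
    by (rule sum.reindex_bij_witness[of _ rev rev]) auto
  finally show ?thesis by (simp add: hermitian_iff_adjoint)
qed

lemma trace_word_sum_real:
  assumes "hermitian A" "hermitian B"
  shows "Im (trace (word_sum m k A B)) = 0"
proof -
  have "cnj (trace (word_sum m k A B)) = trace (word_sum m k A B)"
    using hermitian_word_sum[OF assms] trace_adjoint by (metis hermitian_iff_adjoint)
  then show ?thesis by (simp add: complex_eq_iff)
qed

text \<open>Double counting of pairs (word, position carrying the letter \<open>c\<close>), weighted by the trace of the
  word: each word has as many such positions as it has letters \<open>c\<close>, while by rotation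
  each of the \<open>Suc m\<close> positions contributes the same as the first one.\<close>

lemma trace_letter_times_word_sum:
  fixes A B :: "complex^'n^'n"
  shows "of_nat (Suc m) * trace ((if c then B else A) ** word_sum m k A B)
    = of_nat (if c then Suc k else Suc m - k) * trace (word_sum (Suc m) (k + of_bool c) A B)"
proof -
  let ?W = "words (Suc m) (k + of_bool c)" and ?tr = "\<lambda>w. trace (word_value A B w)"
  define j where "j = (if c then Suc k else Suc m - k)"
  have first: "(\<Sum>w\<in>?W. of_bool (w ! 0 = c) * ?tr w) = trace ((if c then B else A) ** word_sum m k A B)"
  proof -
    have "(\<Sum>w\<in>?W. of_bool (w ! 0 = c) * ?tr w) = (\<Sum>w\<in>Cons c ` words m k. ?tr w)"
    proof (rule sum.mono_neutral_cong_right[OF finite_words])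
      show "Cons c ` words m k \<subseteq> ?W" by auto
      show "\<forall>w\<in>?W - Cons c ` words m k. of_bool (w ! 0 = c) * ?tr w = 0"
        by (cases c) (auto simp: length_Suc_conv)
    qed auto
    also have "\<dots> = (\<Sum>w\<in>words m k. trace ((if c then B else A) ** word_value A B w))"
      by (simp add: sum.reindex)
    also have "\<dots> = trace ((if c then B else A) ** word_sum m k A B)"
      by (simp add: word_sum_def matrix_mult.sum_right trace_sum)
    finally show ?thesis .
  qed
  have position: "(\<Sum>w\<in>?W. of_bool (w ! i = c) * ?tr w) = trace ((if c then B else A) ** word_sum m k A B)"
    if "i < Suc m" for i
  proof -
    have "(\<Sum>w\<in>?W. of_bool (w ! i = c) * ?tr w)
        = (\<Sum>w\<in>?W. of_bool (rotate i w ! 0 = c) * ?tr (rotate i w))"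
      by (rule sum.cong) (use that in \<open>auto simp: trace_rotate nth_rotate\<close>)
    then show ?thesis
      by (simp only: sum_words_rotate[where f = "\<lambda>w. of_bool (w ! 0 = c) * ?tr w"] first)
  qed
  have letters: "(\<Sum>i<Suc m. of_bool (w ! i = c)) = (of_nat j :: complex)" if "w \<in> ?W" for w
  proof -
    have cnt: "(\<Sum>i<length w. of_bool (w ! i = c)) = (of_nat (count_list w c) :: complex)" for w
      by (induction w) (simp_all add: sum.lessThan_Suc_shift del: sum.lessThan_Suc)
    from count_list_True_add_False[of w] have count: "count_list w c = j"
      using that by (cases c) (auto simp: j_def)
    have "length w = Suc m" using that by simp
    with cnt[of w] count show ?thesis by (simp only:)
  qed
  have "of_nat (Suc m) * trace ((if c then B else A) ** word_sum m k A B)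
      = (\<Sum>i<Suc m. trace ((if c then B else A) ** word_sum m k A B))"
    by (simp only: sum_constant card_lessThan)
  also have "\<dots> = (\<Sum>i<Suc m. \<Sum>w\<in>?W. of_bool (w ! i = c) * ?tr w)"
    by (rule sum.cong) (simp_all only: position lessThan_iff)
  also have "\<dots> = (\<Sum>w\<in>?W. (\<Sum>i<Suc m. of_bool (w ! i = c)) * ?tr w)"
    by (subst sum.swap) (simp only: sum_distrib_right)
  also have "\<dots> = (\<Sum>w\<in>?W. of_nat j * ?tr w)"
    by (rule sum.cong) (simp_all only: letters)
  also have "\<dots> = of_nat j * trace (word_sum (Suc m) (k + of_bool c) A B)"
    by (simp add: word_sum_def trace_sum sum_distrib_left)
  finally show ?thesis by (simp add: j_def)
qed

text \<open>Adding one letter at each end is a congruence by the letter, hence the induction in steps of two.\<close>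

lemma psd_power:
  assumes "psd (if c then B else A)"
  shows "psd (word_value A B (replicate m c))"
proof (induction m rule: induct_nat_012)
  case (ge2 m)
  define L where "L = (if c then B else A)"
  have "replicate (Suc (Suc m)) c = c # replicate m c @ [c]"
    by (simp add: replicate_append_same)
  then have "word_value A B (replicate (Suc (Suc m)) c) = L ** word_value A B (replicate m c) ** L"
    by (simp only: word_value_append word_value_Cons word_value_Nil L_def matrix_mul_rid matrix_mul_assoc)
  moreover have "psd (L ** word_value A B (replicate m c) ** L)"
    by (rule psd_congruence) (use ge2 assms in \<open>auto simp: psd_def L_def\<close>)
  ultimately show ?case by simp
qed (use assms in simp_all)

lemma trace_word_sum_single_letter_nonneg:
  assumes "psd (if c then B else A)"
  shows "0 \<le> Re (trace (word_sum m (if c then m else 0) A B))"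
proof -
  have count_replicate: "count_list (replicate m c) True = (if c then m else 0)"
    by (induction m) auto
  have uniform: "w = replicate (length w) x" if "count_list w (\<not> x) = 0" for w and x :: bool
    using that by (induction w) (auto split: if_splits)
  have "w = replicate m c" if w: "w \<in> words m (if c then m else 0)" for w
  proof -
    have "count_list w (\<not> c) = 0" using w count_list_True_add_False[of w] by (cases c) auto
    from uniform[OF this] w show ?thesis by simp
  qed
  then have "words m (if c then m else 0) = {replicate m c}"
    using count_replicate by auto
  then show ?thesis using psd_trace_nonneg[OF psd_power[OF assms]]
    by (simp add: word_sum_def)
qed

lemma word_sum_scaleR:
  assumes "k \<le> m"
  shows "word_sum m k (a *\<^sub>R A) (b *\<^sub>R B) = (a ^ (m - k) * b ^ k) *\<^sub>R word_sum m k A B"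
proof -
  have "word_value (a *\<^sub>R A) (b *\<^sub>R B) w
      = (a ^ (length w - count_list w True) * b ^ count_list w True) *\<^sub>R word_value A B w" for w
  proof (induction w)
    case (Cons c w)
    then show ?case
      by (cases c) (simp_all add: matrix_mult.scaleR_left matrix_mult.scaleR_right
          Suc_diff_le count_le_length algebra_simps)
  qed simp
  then show ?thesis by (simp add: word_sum_def scaleR_sum_right)
qed

section \<open>First variation under congruence\<close>

lemma word_value_has_vector_derivative:
  assumes "(a has_vector_derivative X) (at t)" "(b has_vector_derivative Y) (at t)"
  shows "((\<lambda>s. word_value (a s) (b s) w) has_vector_derivative
    (\<Sum>i<length w. word_value (a t) (b t) (take i w) ** (if w ! i then Y else X)
      ** word_value (a t) (b t) (drop (Suc i) w))) (at t)"
proof (induction w)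
  case (Cons c w)
  have "((\<lambda>s. if c then b s else a s) has_vector_derivative (if c then Y else X)) (at t)"
    using assms by simp
  from matrix_mult.has_vector_derivative[OF this Cons] show ?case
    by (simp add: sum.lessThan_Suc_shift matrix_mult.sum_right matrix_mul_assoc add.commute
        del: sum.lessThan_Suc)
qed simp

definition congruence_curve :: "complex^'n^'n \<Rightarrow> complex^'n^'n \<Rightarrow> real \<Rightarrow> complex^'n^'n" where
  "congruence_curve H A t = (mat 1 + t *\<^sub>R H) ** A ** (mat 1 + t *\<^sub>R H)"

lemma congruence_curve_0 [simp]: "congruence_curve H A 0 = A"
  by (simp add: congruence_curve_def)

lemma psd_congruence_curve: "psd A \<Longrightarrow> hermitian H \<Longrightarrow> psd (congruence_curve H A t)"
  unfolding congruence_curve_def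
  by (rule psd_congruence)
    (auto simp: hermitian_iff_adjoint adjoint_matrix_add adjoint_matrix_scaleR)

lemma congruence_curve_has_vector_derivative:
  "(congruence_curve H A has_vector_derivative (H ** A + A ** H)) (at 0)"
proof -
  have P: "((\<lambda>t. mat 1 + t *\<^sub>R H) has_vector_derivative H) (at 0)"
    by (auto intro!: derivative_eq_intros)
  have "((\<lambda>t. (mat 1 + t *\<^sub>R H) ** A) has_vector_derivative H ** A) (at 0)"
    using matrix_mult.has_vector_derivative[OF P has_vector_derivative_const[of A]] by simp
  from matrix_mult.has_vector_derivative[OF this P] show ?thesis
    by (simp add: congruence_curve_def[abs_def] add.commute)
qed

text \<open>Differentiating the \<open>i\<close>-th letter \<open>L\<close> of a word replaces it by \<open>H ** L + L ** H\<close>, so it inserts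
  \<open>H\<close> before position \<open>i\<close> or before position \<open>Suc i\<close>. Under the trace \<open>H\<close> can be moved to the front
  by rotating the word, and after summation over all words the rotation disappears.\<close>

lemma trace_word_sum_first_variation:
  "((\<lambda>t. Re (trace (word_sum m k (congruence_curve H A t) (congruence_curve H B t))))
    has_real_derivative 2 * m * Re (trace (H ** word_sum m k A B))) (at 0)"
proof -
  let ?D = "\<lambda>w i. word_value A B (take i w)
      ** (if w ! i then H ** B + B ** H else H ** A + A ** H) ** word_value A B (drop (Suc i) w)"
  let ?h = "\<lambda>w. trace (H ** word_value A B w)"
  have rotations: "trace (?D w i) = ?h (rotate i w) + ?h (rotate (Suc i) w)" if "i < length w" for w i
  proof -
    define L where "L = (if w ! i then B else A)"
    have left: "L ** word_value A B (drop (Suc i) w) = word_value A B (drop i w)"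
      using that by (simp add: L_def Cons_nth_drop_Suc[symmetric])
    have right: "word_value A B (take i w) ** L = word_value A B (take (Suc i) w)"
      using that by (simp add: L_def take_Suc_conv_app_nth word_value_append)
    have "?D w i = word_value A B (take i w) ** (H ** L + L ** H) ** word_value A B (drop (Suc i) w)"
      by (simp add: L_def)
    also have "\<dots> = word_value A B (take i w) ** (H ** word_value A B (drop i w))
        + word_value A B (take (Suc i) w) ** (H ** word_value A B (drop (Suc i) w))"
      by (simp add: left[symmetric] right[symmetric] matrix_mult.add_left matrix_mult.add_right
          matrix_mul_assoc)
    finally have "trace (?D w i) = trace (H ** (word_value A B (drop i w) ** word_value A B (take i w)))
        + trace (H ** (word_value A B (drop (Suc i) w) ** word_value A B (take (Suc i) w)))"
      by (simp only: trace_add trace_mul_sym[of "word_value A B (take _ w)"] matrix_mul_assoc[of H])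
    then show ?thesis
      using that by (simp add: rotate_eq word_value_append del: rotate_Suc)
  qed
  have sum_h: "(\<Sum>w\<in>words m k. ?h (rotate i w)) = trace (H ** word_sum m k A B)" for i
    by (simp add: sum_words_rotate[where f = ?h] word_sum_def matrix_mult.sum_right trace_sum)
  have "((\<lambda>t. word_sum m k (congruence_curve H A t) (congruence_curve H B t))
      has_vector_derivative (\<Sum>w\<in>words m k. \<Sum>i<length w. ?D w i)) (at 0)"
    unfolding word_sum_def
  proof (rule has_vector_derivative_sum)
    fix w
    show "((\<lambda>t. word_value (congruence_curve H A t) (congruence_curve H B t) w)
        has_vector_derivative (\<Sum>i<length w. ?D w i)) (at 0)"
      using word_value_has_vector_derivative[OF congruence_curve_has_vector_derivative
          congruence_curve_has_vector_derivative, of H A H B w]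
      by (simp only: congruence_curve_0)
  qed
  from bounded_linear.has_vector_derivative
    [OF bounded_linear_compose[OF bounded_linear_Re trace_bounded_linear] this]
  have "((\<lambda>t. Re (trace (word_sum m k (congruence_curve H A t) (congruence_curve H B t))))
      has_real_derivative Re (trace (\<Sum>w\<in>words m k. \<Sum>i<length w. ?D w i))) (at 0)"
    by (simp add: has_real_derivative_iff_has_vector_derivative)
  moreover have "trace (\<Sum>w\<in>words m k. \<Sum>i<length w. ?D w i)
      = 2 * of_nat m * trace (H ** word_sum m k A B)"
  proof -
    have "trace (\<Sum>w\<in>words m k. \<Sum>i<length w. ?D w i)
        = (\<Sum>w\<in>words m k. \<Sum>i<m. ?h (rotate i w) + ?h (rotate (Suc i) w))"
      by (simp add: trace_sum rotations del: rotate_Suc)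
    also have "\<dots> = (\<Sum>i<m. \<Sum>w\<in>words m k. ?h (rotate i w) + ?h (rotate (Suc i) w))"
      by (rule sum.swap)
    also have "\<dots> = 2 * of_nat m * trace (H ** word_sum m k A B)"
      by (simp add: sum.distrib sum_h del: rotate_Suc)
    finally show ?thesis .
  qed
  ultimately show ?thesis by simp
qed

lemma norm_congruence_curve_derivative:
  assumes "hermitian A" "norm A = 1"
  shows "((\<lambda>t. norm (congruence_curve H A t)) has_real_derivative
    2 * Re (trace (H ** (A ** A)))) (at 0)"
proof -
  have "A \<noteq> 0" using assms(2) by auto
  then have "(norm has_derivative (\<lambda>h. h \<bullet> sgn (congruence_curve H A 0))) (at (congruence_curve H A 0))"
    by (simp add: has_derivative_norm)
  from has_derivative_compose[OF congruence_curve_has_vector_derivative[unfolded has_vector_derivative_def] this]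
  have "((\<lambda>t. norm (congruence_curve H A t)) has_real_derivative (H ** A + A ** H) \<bullet> A) (at 0)"
    by (simp add: has_field_derivative_def sgn_div_norm assms(2) mult.commute[of _ "_ \<bullet> _"])
  moreover have "(H ** A + A ** H) \<bullet> A = 2 * Re (trace (H ** (A ** A)))"
  proof -
    have "(H ** A + A ** H) \<bullet> A = Re (trace (A ** (H ** A))) + Re (trace (A ** (A ** H)))"
      by (simp add: hermitian_trace_mult[OF assms(1)] inner_add_right inner_commute[of _ A])
    also have "trace (A ** (H ** A)) = trace (H ** (A ** A))"
      by (metis matrix_mul_assoc trace_mul_sym)
    also have "trace (A ** (A ** H)) = trace (H ** (A ** A))"
      by (metis matrix_mul_assoc trace_mul_sym)
    finally show ?thesis by simp
  qed
  ultimately show ?thesis by simp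
qed

section \<open>Minimisers and their Euler-Lagrange equation\<close>

text \<open>For \<open>A = 0\<close> any positive semidefinite \<open>U\<close> of norm one serves, so the case of a zero matrix needs
  no separate treatment in homogeneity arguments.\<close>

lemma psd_eq_norm_times_unit:
  fixes A :: "complex^'n^'n"
  assumes "psd A"
  obtains U where "psd U" "norm U = 1" "A = norm A *\<^sub>R U"
proof -
  have normalise: "psd (X /\<^sub>R norm X) \<and> norm (X /\<^sub>R norm X) = 1 \<and> X = norm X *\<^sub>R (X /\<^sub>R norm X)"
    if "psd X" "X \<noteq> 0" for X :: "complex^'n^'n"
    using that psd_scaleR[of X "inverse (norm X)"] by simp
  show thesis
  proof (cases "A = 0")
    case True
    have "mat 1 \<noteq> (0 :: complex^'n^'n)" by (simp add: vec_eq_iff mat_def)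
    with normalise[of "mat 1"] True show thesis by (intro that) auto
  next
    case False
    with normalise[of A] assms show thesis by (intro that) auto
  qed
qed

lemma continuous_on_word_sum:
  assumes "continuous_on S a" "continuous_on S b"
  shows "continuous_on S (\<lambda>x. word_sum m k (a x) (b x))"
proof -
  have "continuous_on S (\<lambda>x. word_value (a x) (b x) w)" for w
  proof (induction w)
    case (Cons c w)
    have "continuous_on S (\<lambda>x. if c then b x else a x)" using assms by (cases c) simp_all
    with Cons show ?case by (simp add: matrix_mult.continuous_on)
  qed simp
  then show ?thesis unfolding word_sum_def by (intro continuous_intros)
qed

text \<open>The minimum over the compact set of pairs of unit norm is turned by homogeneity into an inequality
  on all positive semidefinite pairs, so that variations need not preserve the norms.\<close>

lemma negative_minimiser_exists:
  fixes A\<^sub>0 B\<^sub>0 :: "complex^'n^'n"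
  assumes "k \<le> m" "psd A\<^sub>0" "psd B\<^sub>0" "Re (trace (word_sum m k A\<^sub>0 B\<^sub>0)) < 0"
  obtains A B :: "complex^'n^'n" where
    "psd A" "psd B" "norm A = 1" "norm B = 1" "Re (trace (word_sum m k A B)) < 0"
    "\<And>A' B' :: complex^'n^'n. psd A' \<Longrightarrow> psd B' \<Longrightarrow>
      Re (trace (word_sum m k A B)) * (norm A' ^ (m - k) * norm B' ^ k) \<le> Re (trace (word_sum m k A' B'))"
proof -
  define F where "F = (\<lambda>A B :: complex^'n^'n. Re (trace (word_sum m k A B)))"
  define S where "S = {A :: complex^'n^'n. psd A} \<inter> sphere 0 1"
  have S: "compact S" unfolding S_def by (intro closed_Int_compact closed_psd) simp
  have F_scale: "F (r *\<^sub>R U) (s *\<^sub>R V) = F U V * (r ^ (m - k) * s ^ k)" for r s U V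
    by (simp add: F_def word_sum_scaleR[OF assms(1)]
        linear_scale[OF bounded_linear.linear[OF trace_bounded_linear]])
  obtain U\<^sub>0 where U\<^sub>0: "psd U\<^sub>0" "norm U\<^sub>0 = 1" "A\<^sub>0 = norm A\<^sub>0 *\<^sub>R U\<^sub>0"
    using psd_eq_norm_times_unit[OF assms(2)] by blast
  obtain V\<^sub>0 where V\<^sub>0: "psd V\<^sub>0" "norm V\<^sub>0 = 1" "B\<^sub>0 = norm B\<^sub>0 *\<^sub>R V\<^sub>0"
    using psd_eq_norm_times_unit[OF assms(3)] by blast
  have "F A\<^sub>0 B\<^sub>0 = F U\<^sub>0 V\<^sub>0 * (norm A\<^sub>0 ^ (m - k) * norm B\<^sub>0 ^ k)"
    using F_scale U\<^sub>0(3) V\<^sub>0(3) by metis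
  then have neg: "F U\<^sub>0 V\<^sub>0 < 0"
    using assms(4) by (smt (verit) F_def mult_nonneg_nonneg norm_ge_zero zero_le_power)
  have "continuous_on (S \<times> S) (\<lambda>p. F (fst p) (snd p))"
    unfolding F_def
    by (intro continuous_intros bounded_linear.continuous_on[OF trace_bounded_linear]
        continuous_on_word_sum)
  moreover have "(U\<^sub>0, V\<^sub>0) \<in> S \<times> S" using U\<^sub>0 V\<^sub>0 by (simp add: S_def)
  ultimately obtain p where p: "p \<in> S \<times> S"
    and min_p: "\<And>q. q \<in> S \<times> S \<Longrightarrow> F (fst p) (snd p) \<le> F (fst q) (snd q)"
    using continuous_attains_inf[OF compact_Times[OF S S], of "\<lambda>p. F (fst p) (snd p)"] by blast
  define A B where "A = fst p" "B = snd p"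
  have min: "F A B \<le> F U V" if "U \<in> S" "V \<in> S" for U V
    using min_p[of "(U, V)"] that by (simp add: A_B_def)
  show thesis
  proof (rule that[of A B])
    show "psd A" "psd B" "norm A = 1" "norm B = 1" using p by (auto simp: A_B_def S_def)
    have "F A B \<le> F U\<^sub>0 V\<^sub>0" by (rule min) (use U\<^sub>0 V\<^sub>0 in \<open>auto simp: S_def\<close>)
    with neg show "Re (trace (word_sum m k A B)) < 0" by (simp add: F_def)
    fix A' B' :: "complex^'n^'n" assume "psd A'" "psd B'"
    obtain U where U: "psd U" "norm U = 1" "A' = norm A' *\<^sub>R U"
      using psd_eq_norm_times_unit[OF \<open>psd A'\<close>] by blast
    obtain V where V: "psd V" "norm V = 1" "B' = norm B' *\<^sub>R V"
      using psd_eq_norm_times_unit[OF \<open>psd B'\<close>] by blast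
    have "F A B * (norm A' ^ (m - k) * norm B' ^ k) \<le> F U V * (norm A' ^ (m - k) * norm B' ^ k)"
      by (intro mult_right_mono min) (use U V in \<open>auto simp: S_def\<close>)
    also have "\<dots> = F A' B'" using F_scale U(3) V(3) by metis
    finally show "Re (trace (word_sum m k A B)) * (norm A' ^ (m - k) * norm B' ^ k)
        \<le> Re (trace (word_sum m k A' B'))"
      by (simp add: F_def)
  qed
qed

text \<open>The Euler-Lagrange equation of the minimiser, tested against \<open>H\<close>: the difference of the two sides of
  the minimality inequality along the congruence curves is nonnegative and vanishes at \<open>t = 0\<close>.\<close>

lemma minimiser_stationary:
  fixes A B H :: "complex^'n^'n"
  assumes "psd A" "psd B" "norm A = 1" "norm B = 1" "hermitian H"
    and f: "f = Re (trace (word_sum m k A B))"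
    and min: "\<And>A' B' :: complex^'n^'n. psd A' \<Longrightarrow> psd B' \<Longrightarrow>
      f * (norm A' ^ (m - k) * norm B' ^ k) \<le> Re (trace (word_sum m k A' B'))"
  shows "m * Re (trace (H ** word_sum m k A B))
    = f * (real (m - k) * Re (trace (H ** (A ** A))) + k * Re (trace (H ** (B ** B))))"
proof -
  let ?a = "congruence_curve H A" and ?b = "congruence_curve H B"
  define g where "g t = Re (trace (word_sum m k (?a t) (?b t)))
      - f * (norm (?a t) ^ (m - k) * norm (?b t) ^ k)" for t
  have herm: "hermitian A" "hermitian B" using assms(1,2) by (simp_all add: psd_def)
  note [derivative_intros] =
    trace_word_sum_first_variation[of m k H A B]
    norm_congruence_curve_derivative[OF herm(1) assms(3), of H]
    norm_congruence_curve_derivative[OF herm(2) assms(4), of H]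
  let ?g' = "2 * m * Re (trace (H ** word_sum m k A B))
      - 2 * f * (real (m - k) * Re (trace (H ** (A ** A))) + k * Re (trace (H ** (B ** B))))"
  have "(g has_real_derivative ?g') (at 0)"
    unfolding g_def by (rule derivative_eq_intros refl)+ (simp add: assms(3,4) algebra_simps)
  moreover have "g 0 \<le> g t" for t
    using min[OF psd_congruence_curve psd_congruence_curve, OF assms(1,5,2,5), of t t]
    by (simp add: g_def assms(3,4) f)
  ultimately have "?g' = 0" using DERIV_local_min[of g ?g' 0 1] by simp
  then show ?thesis by simp
qed

section \<open>Adding one letter\<close>

lemma positive_definite_perturbation:
  fixes A B :: "complex^'n^'n"
  assumes "psd A" "psd B" "Re (trace (word_sum m k A B)) < 0"
  obtains A' B' :: "complex^'n^'n" where
    "positive_definite A'" "positive_definite B'" "trace (word_sum m k A' B') < 0"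
proof -
  define F where "F e = Re (trace (word_sum m k (A + e *\<^sub>R mat 1) (B + e *\<^sub>R mat 1)))" for e
  have "continuous_on UNIV F" unfolding F_def
    by (intro continuous_intros bounded_linear.continuous_on[OF trace_bounded_linear]
        continuous_on_word_sum)
  then have "isCont F 0" by (simp add: continuous_on_eq_continuous_at)
  then have "(F \<longlongrightarrow> F 0) (at_right 0)"
    by (simp add: isCont_def filterlim_at_split)
  moreover have "F 0 < 0" using assms(3) by (simp add: F_def)
  ultimately have "\<forall>\<^sub>F e in at_right 0. F e < 0" by (rule order_tendstoD(2))
  then have "\<forall>\<^sub>F e in at_right 0. F e < 0 \<and> e > 0"
    by (intro eventually_conj eventually_at_right_less)
  then obtain e where "F e < 0" "e > 0"
    using eventually_happens trivial_limit_at_right_real by blast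
  let ?A = "A + e *\<^sub>R mat 1" and ?B = "B + e *\<^sub>R mat 1"
  have pd: "positive_definite ?A" "positive_definite ?B"
    using psd_add_scaled_identity assms(1,2) \<open>e > 0\<close> by blast+
  then have "Im (trace (word_sum m k ?A ?B)) = 0"
    by (intro trace_word_sum_real) (simp_all add: positive_definite_def)
  with \<open>F e < 0\<close> have "trace (word_sum m k ?A ?B) < 0" by (simp add: F_def less_complex_def)
  with pd show thesis by (rule that)
qed

text \<open>The Euler-Lagrange equation is tested against the letter \<open>L\<close> to be added: one of \<open>L ** (A ** A)\<close>,
  \<open>L ** (B ** B)\<close> is then a cube, with positive trace, and the other has nonnegative trace.\<close>

lemma negative_trace_add_letter:
  fixes A\<^sub>0 B\<^sub>0 :: "complex^'n^'n"
  assumes "k \<le> m" "positive_definite A\<^sub>0" "positive_definite B\<^sub>0" "trace (word_sum m k A\<^sub>0 B\<^sub>0) < 0"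
  shows "\<exists>A B :: complex^'n^'n. positive_definite A \<and> positive_definite B \<and>
    trace (word_sum (Suc m) (k + of_bool c) A B) < 0"
proof -
  have "Re (trace (word_sum m k A\<^sub>0 B\<^sub>0)) < 0" using assms(4) by (simp add: less_complex_def)
  from negative_minimiser_exists[OF assms(1) positive_definite_imp_psd[OF assms(2)]
      positive_definite_imp_psd[OF assms(3)] this]
  obtain A B :: "complex^'n^'n" where psd: "psd A" "psd B" and norm: "norm A = 1" "norm B = 1"
    and neg: "Re (trace (word_sum m k A B)) < 0"
    and min: "\<And>A' B' :: complex^'n^'n. psd A' \<Longrightarrow> psd B' \<Longrightarrow>
      Re (trace (word_sum m k A B)) * (norm A' ^ (m - k) * norm B' ^ k) \<le> Re (trace (word_sum m k A' B'))"
    by blast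
  define f where "f = Re (trace (word_sum m k A B))"
  define L where "L = (if c then B else A)"
  have herm: "hermitian A" "hermitian B" and L: "psd L" "hermitian L"
    using psd by (auto simp: psd_def L_def)
  have "A \<noteq> 0" "B \<noteq> 0" using norm by auto
  (* otherwise the word sum would be a power of a single letter, with nonnegative trace *)
  have both: "0 < k" "k < m"
    using trace_word_sum_single_letter_nonneg[of False B A m] trace_word_sum_single_letter_nonneg[of True B A m]
      psd neg assms(1) by (auto intro!: gr0I le_neq_implies_less)
  have "0 < real (m - k) * Re (trace (L ** (A ** A))) + k * Re (trace (L ** (B ** B)))"
  proof (cases c)
    case True
    then have "0 < Re (trace (L ** (B ** B)))" "0 \<le> Re (trace (L ** (A ** A)))"
      using psd_trace_cube_pos[OF psd(2) \<open>B \<noteq> 0\<close>] psd_trace_mult_square_nonneg[OF psd(2) herm(1)]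
      by (simp_all add: L_def matrix_mul_assoc)
    then show ?thesis using both by (simp add: add_nonneg_pos)
  next
    case False
    then have "0 < Re (trace (L ** (A ** A)))" "0 \<le> Re (trace (L ** (B ** B)))"
      using psd_trace_cube_pos[OF psd(1) \<open>A \<noteq> 0\<close>] psd_trace_mult_square_nonneg[OF psd(1) herm(2)]
      by (simp_all add: L_def matrix_mul_assoc)
    then show ?thesis using both by (simp add: add_pos_nonneg)
  qed
  with neg have "f * (real (m - k) * Re (trace (L ** (A ** A))) + k * Re (trace (L ** (B ** B)))) < 0"
    by (simp add: f_def mult_neg_pos)
  then have "m * Re (trace (L ** word_sum m k A B)) < 0"
    by (subst minimiser_stationary[OF psd norm L(2) f_def]) (simp_all add: f_def min)
  then have LS: "Re (trace (L ** word_sum m k A B)) < 0" by (simp add: mult_less_0_iff)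
  have "Re (of_nat (Suc m) * trace (L ** word_sum m k A B))
      = Re (of_nat (if c then Suc k else Suc m - k) * trace (word_sum (Suc m) (k + of_bool c) A B))"
    by (simp only: L_def trace_letter_times_word_sum)
  moreover have "Re (of_nat n * z) = real n * Re z" for n z by simp
  ultimately have "real (Suc m) * Re (trace (L ** word_sum m k A B))
      = real (if c then Suc k else Suc m - k) * Re (trace (word_sum (Suc m) (k + of_bool c) A B))"
    by (simp only:)
  moreover have "real (Suc m) * Re (trace (L ** word_sum m k A B)) < 0"
    using LS by (intro mult_pos_neg) auto
  ultimately have "Re (trace (word_sum (Suc m) (k + of_bool c) A B)) < 0"
    by (metis mult_less_0_iff of_nat_less_0_iff)
  from positive_definite_perturbation[OF psd this] show ?thesis by blast
qed

theorem theorem1p7: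
  fixes M K m k :: nat
  assumes "M \<ge> K"
    and "\<exists>A B :: complex^'n^'n.
      positive_definite A \<and> positive_definite B \<and> trace (word_sum M K A B) < 0"
    and "m \<ge> M" and "k \<ge> K" and "int m - int k \<ge> int M - int K"
  shows "\<exists>A' B' :: complex^'n^'n.
      positive_definite A' \<and> positive_definite B' \<and> trace (word_sum m k A' B') < 0"
proof -
  let ?neg = "\<lambda>m k. \<exists>A B :: complex^'n^'n.
      positive_definite A \<and> positive_definite B \<and> trace (word_sum m k A B) < 0"
  have add_A: "?neg (M + p) K" for p
  proof (induction p)
    case (Suc p)
    then show ?case using negative_trace_add_letter[of K "M + p" _ _ False] assms(1) by auto
  qed (use assms(2) in simp)
  have add_B: "?neg (M + p + q) (K + q)" for p q
  proof (induction q)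
    case (Suc q)
    then show ?case using negative_trace_add_letter[of "K + q" "M + p + q" _ _ True] assms(1) by auto
  qed (use add_A in simp)
  (* the numbers of letters B and A that have to be added *)
  define q p where "q = k - K" and "p = m - M - q"
  have "m = M + p + q" "k = K + q" using assms by (auto simp: q_def p_def)
  then show ?thesis using add_B by simp
qed

end
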